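(* For any positive integers $n$ and $d\ge 2$, and any $p=p(n)$, there exists an $n$-vertex directed graph $G$ and a set $\mathcal{P}$ of $p$ vertex pairs such that any 1-fault-tolerant reachability oracle of $G$ for $\mathcal{P}$ must have size $\Omega\big(n^{2/(d+1)}p^{(d-1)/d}\big)$ bits.
   Context: For a directed graph $G=(V,E)$ and $\mathcal{P}\subseteq V\times V$, a $k$-fault-tolerant reachability oracle of $G$ for $\mathcal{P}$ is a data structure that, given any pair $(s,t)\in\mathcal{P}$ and any set $F\subseteq E$ of at most $k$ edges, decides whether $t$ is reachable from $s$ in $G\setminus F$ (the graph with the edges of $F$ deleted). *)

theory Defs
  imports Complex_Main "Graph_Theory.Graph_Theory"
begin

definition delete_edges :: "'a pair_pre_digraph \<Rightarrow> 'a rel \<Rightarrow> 'a pair_pre_digraph" where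
  "delete_edges G F = G\<lparr>parcs := parcs G - F\<rparr>"

text \<open>
  A query procedure fixes how stored bits are interpreted as a data structure: it receives the
  stored bit string, a vertex pair and a set of deleted edges, and has no other access to the
  graph. It may be an arbitrary function, so lower bounds that hold for every query procedure
  are information-theoretic.
\<close>

type_synonym 'a query_procedure = "bool list \<Rightarrow> 'a \<times> 'a \<Rightarrow> 'a rel \<Rightarrow> bool"

text \<open>
  The bit string \<open>B\<close> is an oracle if the queries allowed by the definition are answered
  correctly; nothing is required for pairs outside \<open>P\<close>, for sets \<open>F\<close> with more than \<open>k\<close> edges
  or for sets \<open>F\<close> containing non-edges. For finite \<open>G\<close> every such \<open>F\<close> is finite, so \<open>card\<close> is the
  true number of deleted edges. The size of the oracle in bits is \<open>length B\<close>.
\<close>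

definition ft_reachability_oracle ::
    "nat \<Rightarrow> 'a pair_pre_digraph \<Rightarrow> 'a rel \<Rightarrow> 'a query_procedure \<Rightarrow> bool list \<Rightarrow> bool" where
  "ft_reachability_oracle k G P Q B \<longleftrightarrow>
     (\<forall>(s, t) \<in> P. \<forall>F \<subseteq> parcs G. card F \<le> k \<longrightarrow>
        (Q B (s, t) F \<longleftrightarrow> s \<rightarrow>\<^sup>*\<^bsub>with_proj (delete_edges G F)\<^esub> t))"

end

theory Submission
  imports Defs "HOL-Library.FuncSet"
begin

text \<open>
  If every edge of a base graph lies on all paths between the vertices of some pair of \<open>P\<close>, then
  giving each edge an optional detour makes every 1-fault-tolerant oracle for \<open>P\<close> encode one free bit
  per base edge, so its size is at least the number of base edges. Three base graphs cover all \<open>p\<close>, where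
  \<open>n \<approx> N\<^sup>d\<^sup>+\<^sup>1\<close> and \<open>p \<approx> q\<^sup>d\<close>: a path if \<open>q \<le> N\<close>, a bipartite graph if \<open>q \<ge> N\<^sup>2\<close>, and otherwise a layered
  lattice graph with \<open>N\<^sup>2 / q\<close> layers whose edge directions \<open>(w, \<bar>w\<bar>\<^sup>2)\<close>, with \<open>w\<close> in a cube of side
  \<open>q / N\<close> and dimension \<open>d - 1\<close>, lie on a paraboloid. By strict convexity a straight line is the
  only path between its end points, and different lines share no edge.
\<close>

section \<open>Counting short bit strings\<close>

lemma card_short_bit_strings:
  "card {B :: bool list. length B < m} < 2 ^ m"
proof (cases m)
  case (Suc l)
  have "card {B :: bool list. length B < m} = (\<Sum>i\<le>l. 2 ^ i)"
    using card_lists_length_le[of "UNIV :: bool set" l] Suc by (simp add: less_Suc_eq_le)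
  also have "\<dots> = 2 ^ m - 1"
    using mask_eq_sum_exp_nat[of m] Suc by (simp add: atMost_def less_Suc_eq_le)
  also have "\<dots> < (2 ^ m :: nat)"
    by simp
  finally show ?thesis .
qed simp

text \<open>There are \<open>2 ^ card E\<close> subsets but fewer shorter strings, so two distinct
  subsets collide. Swapping them if necessary gives the asymmetric form, which supplies an edge of
  \<open>X\<close> outside \<open>Y\<close>.\<close>

lemma short_encoding_collision:
  fixes f :: "'a set \<Rightarrow> bool list"
  assumes "finite E" and short: "\<And>X. X \<subseteq> E \<Longrightarrow> length (f X) < card E"
  obtains X Y where "X \<subseteq> E" "Y \<subseteq> E" "\<not> X \<subseteq> Y" "f X = f Y"
proof -
  have fin: "finite {B :: bool list. length B < card E}"
    using finite_lists_length_le[of "UNIV :: bool set" "card E"]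
    by (auto elim!: rev_finite_subset)
  have "\<not> inj_on f (Pow E)"
  proof
    assume "inj_on f (Pow E)"
    moreover have "f ` Pow E \<subseteq> {B. length B < card E}"
      using short by auto
    ultimately have "card (Pow E) \<le> card {B :: bool list. length B < card E}"
      using fin by (rule card_inj_on_le)
    thus False
      using card_short_bit_strings[of "card E"] \<open>finite E\<close> by (simp add: card_Pow)
  qed
  then obtain X Y where "X \<subseteq> E" "Y \<subseteq> E" "X \<noteq> Y" "f X = f Y"
    by (auto simp: inj_on_def)
  thus thesis
    using that[of X Y] that[of Y X] by auto
qed

section \<open>From critical edges to oracle size\<close>

definition critical_edge :: "'a rel \<Rightarrow> 'a \<times> 'a \<Rightarrow> 'a \<times> 'a \<Rightarrow> bool" where
  "critical_edge E e q \<longleftrightarrow> q \<in> E\<^sup>* \<and> q \<notin> (E - {e})\<^sup>*"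

text \<open>Reachability in a digraph is closure relative to the vertex set. Arcs of a well-formed
  graph end in vertices, so a walk starting at a vertex stays among them and only its start needs
  checking.\<close>

lemma reachable_with_proj_iff:
  assumes "pair_wf_digraph G"
  shows "s \<rightarrow>\<^sup>*\<^bsub>with_proj (delete_edges G F)\<^esub> t \<longleftrightarrow> s \<in> pverts G \<and> (s, t) \<in> (parcs G - F)\<^sup>*"
proof
  assume "s \<rightarrow>\<^sup>*\<^bsub>with_proj (delete_edges G F)\<^esub> t"
  hence "(s, t) \<in> rtrancl_on (pverts G) (parcs G - F)"
    by (simp add: reachable_def delete_edges_def)
  thus "s \<in> pverts G \<and> (s, t) \<in> (parcs G - F)\<^sup>*"
    by (auto dest: in_rtrancl_on_in_F rtrancl_on_rtranclI)
next
  assume *: "s \<in> pverts G \<and> (s, t) \<in> (parcs G - F)\<^sup>*"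
  hence "(s, t) \<in> (parcs G - F)\<^sup>*" by blast
  hence "(s, t) \<in> rtrancl_on (pverts G) (parcs G - F)"
  proof (induction rule: rtrancl_induct)
    case base
    thus ?case using * by simp
  next
    case (step y z)
    hence "z \<in> pverts G"
      using pair_wf_digraph.in_arcsD2[OF assms] by blast
    thus ?case
      using step by (metis rtrancl_on_into_rtrancl_on)
  qed
  thus "s \<rightarrow>\<^sup>*\<^bsub>with_proj (delete_edges G F)\<^esub> t"
    by (simp add: reachable_def delete_edges_def)
qed

text \<open>
  Every vertex \<open>u\<close> of the base graph gets a twin \<open>(u, True)\<close>, entered from \<open>u = (u, False)\<close> only; the
  twin copies exactly the edges of \<open>X\<close>. Deleting a base edge \<open>e\<close> thus reveals whether \<open>e \<in> X\<close>.
\<close>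

definition twin_arcs :: "('a \<times> bool \<Rightarrow> 'b) \<Rightarrow> 'a set \<Rightarrow> 'a rel \<Rightarrow> 'a rel \<Rightarrow> 'b rel" where
  "twin_arcs g V E X =
     (\<lambda>(u, v). (g (u, False), g (v, False))) ` E \<union>
     (\<lambda>u. (g (u, False), g (u, True))) ` V \<union>
     (\<lambda>(u, v). (g (u, True), g (v, False))) ` X"

text \<open>If \<open>(u, v)\<close> is in \<open>X\<close>, the detour through the twin of
  \<open>u\<close> replaces the deleted arc. Otherwise merging twins turns every remaining arc into
  a standstill or an edge of \<open>E - {(u, v)}\<close>, so a walk would contradict
  criticality.\<close>

lemma twin_arcs_reachable_iff:
  assumes inj: "inj_on g (V \<times> UNIV)" and E: "E \<subseteq> V \<times> V" and X: "X \<subseteq> E"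
    and uv: "(u, v) \<in> E" and st: "s \<in> V" "t \<in> V" and crit: "critical_edge E (u, v) (s, t)"
  shows "(g (s, False), g (t, False)) \<in>
      (twin_arcs g V E X - {(g (u, False), g (v, False))})\<^sup>* \<longleftrightarrow> (u, v) \<in> X"
    (is "_ \<in> ?A\<^sup>* \<longleftrightarrow> _")
proof
  assume reach: "(g (s, False), g (t, False)) \<in> ?A\<^sup>*"
  show "(u, v) \<in> X"
  proof (rule ccontr)
    assume notin: "(u, v) \<notin> X"
    \<comment> \<open>The projection \<open>h\<close> undoes the numbering \<open>g\<close> and
      forgets the twin bit.\<close>
    define h where "h = fst \<circ> the_inv_into (V \<times> UNIV) g"
    have h: "h (g (w, b)) = w" if "w \<in> V" for w b
      using that by (simp add: h_def the_inv_into_f_f[OF inj])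
    have "h x = h y \<or> (h x, h y) \<in> E - {(u, v)}" if "(x, y) \<in> ?A" for x y
    proof -
      from that consider
          a b where "(a, b) \<in> E - {(u, v)}" "x = g (a, False)" "y = g (b, False)"
        | a where "a \<in> V" "x = g (a, False)" "y = g (a, True)"
        | a b where "(a, b) \<in> X" "x = g (a, True)" "y = g (b, False)"
        unfolding twin_arcs_def by auto
      thus ?thesis
      proof cases
        case 1
        thus ?thesis using E by (auto simp: h subset_iff)
      next
        case 2
        thus ?thesis by (simp add: h)
      next
        case 3
        hence "a \<in> V" "b \<in> V" "(a, b) \<in> E - {(u, v)}"
          using E X notin by auto
        thus ?thesis using 3 by (simp add: h)
      qed
    qed
    hence proj_step: "(h x, h y) \<in> (E - {(u, v)})\<^sup>*" if "(x, y) \<in> ?A" for x y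
      using that by (metis r_into_rtrancl rtrancl.rtrancl_refl)
    have "(h (g (s, False)), h y) \<in> (E - {(u, v)})\<^sup>*" if "(g (s, False), y) \<in> ?A\<^sup>*" for y
      using that
    proof (induction rule: rtrancl_induct)
      case (step x y)
      show ?case
        by (rule rtrancl_trans[OF step.IH proj_step[OF step.hyps(2)]])
    qed simp
    from this[OF reach] show False
      using crit st by (simp add: h critical_edge_def)
  qed
next
  assume uvX: "(u, v) \<in> X"
  have g_eq: "g (w, b) = g (w', b') \<longleftrightarrow> w = w' \<and> b = b'" if "w \<in> V" "w' \<in> V" for w w' b b'
    using that inj_on_eq_iff[OF inj, of "(w, b)" "(w', b')"] by simp
  have step: "(g (x, False), g (y, False)) \<in> ?A\<^sup>*" if xy: "(x, y) \<in> E" for x y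
  proof (cases "(x, y) = (u, v)")
    case True
    have "u \<in> V" "v \<in> V"
      using uv E by auto
    hence "(g (u, False), g (u, True)) \<in> ?A" "(g (u, True), g (v, False)) \<in> ?A"
      using uvX by (auto simp: twin_arcs_def g_eq)
    thus ?thesis
      using True by (auto intro: rtrancl_trans)
  next
    case False
    have "(g (x, False), g (y, False)) \<in> ?A"
    proof -
      have "x \<in> V" "y \<in> V" "u \<in> V" "v \<in> V"
        using xy uv E by auto
      thus ?thesis
        using False xy by (auto simp: twin_arcs_def g_eq)
    qed
    thus ?thesis by blast
  qed
  have "(g (s, False), g (y, False)) \<in> ?A\<^sup>*" if "(s, y) \<in> E\<^sup>*" for y
    using that by (induction rule: rtrancl_induct) (auto dest: step)
  thus "(g (s, False), g (t, False)) \<in> ?A\<^sup>*"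
    using crit by (simp add: critical_edge_def)
qed

text \<open>The query procedure is fixed first, so the hard graph and the pair set may depend on
  it.\<close>

definition oracle_bound :: "nat \<Rightarrow> nat \<Rightarrow> nat query_procedure \<Rightarrow> nat \<Rightarrow> bool" where
  "oracle_bound n p Q m \<longleftrightarrow> (\<exists>G P. pair_fin_digraph G \<and> pverts G = {..<n} \<and>
     P \<subseteq> pverts G \<times> pverts G \<and> card P = p \<and>
     (\<forall>B. ft_reachability_oracle 1 G P Q B \<longrightarrow> m \<le> length B))"

text \<open>If every \<open>X \<subseteq> E\<close> had an oracle shorter than
  \<open>card E\<close>, two subsets would share one, and deleting an edge in which they differ
  would demand two different answers from it. The factor 2 in front of \<open>card V\<close> pays
  for the twins.\<close>

lemma oracle_bound_of_critical_edges:
  fixes V :: "'a set"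
  assumes "finite V" and E: "E \<subseteq> V \<times> V" and R: "R \<subseteq> V \<times> V"
    and n: "2 * card V \<le> n" and p: "card R \<le> p" "p \<le> n\<^sup>2"
    and crit: "\<And>e. e \<in> E \<Longrightarrow> \<exists>r\<in>R. critical_edge E e r"
  shows "oracle_bound n p Q (card E)"
proof -
  have "card (V \<times> (UNIV :: bool set)) \<le> card {..<n}"
    using n by (simp add: card_cartesian_product)
  then obtain g where g: "g ` (V \<times> UNIV) \<subseteq> {..<n}" and inj: "inj_on g (V \<times> (UNIV :: bool set))"
    using card_le_inj[of "V \<times> (UNIV :: bool set)" "{..<n}"] \<open>finite V\<close> by auto
  have finE: "finite E"
    using E \<open>finite V\<close> by (meson finite_SigmaI finite_subset)
  define P\<^sub>0 where "P\<^sub>0 = (\<lambda>(s, t). (g (s, False), g (t, False))) ` R"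
  have "P\<^sub>0 \<subseteq> {..<n} \<times> {..<n}"
    using g R by (fastforce simp: P\<^sub>0_def)
  moreover have "card P\<^sub>0 \<le> p"
    using card_image_le[of R] R p(1) \<open>finite V\<close>
    by (metis P\<^sub>0_def finite_SigmaI finite_subset le_trans)
  moreover have "p \<le> card ({..<n} \<times> {..<n})"
    using p(2) by (simp add: power2_eq_square)
  \<comment> \<open>Padding to exactly \<open>p\<close> pairs is harmless: further pairs only add
    demands on an oracle.\<close>
  ultimately obtain P where P: "P\<^sub>0 \<subseteq> P" "P \<subseteq> {..<n} \<times> {..<n}" "card P = p"
    by (metis exists_subset_between finite_SigmaI finite_lessThan)
  define G where "G X = \<lparr>pverts = {..<n}, parcs = twin_arcs g V E X\<rparr>" for X
  have G: "pair_fin_digraph (G X)" if "X \<subseteq> E" for X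
  proof
    have "twin_arcs g V E X \<subseteq> {..<n} \<times> {..<n}"
      using that E g by (fastforce simp: twin_arcs_def)
    thus "\<And>e. e \<in> parcs (G X) \<Longrightarrow> fst e \<in> pverts (G X)"
      and "\<And>e. e \<in> parcs (G X) \<Longrightarrow> snd e \<in> pverts (G X)"
      by (auto simp: G_def)
    show "finite (parcs (G X))"
      using \<open>twin_arcs g V E X \<subseteq> _\<close> by (auto simp: G_def intro: finite_subset)
  qed (simp add: G_def)
  have "\<exists>X\<subseteq>E. \<forall>B. ft_reachability_oracle 1 (G X) P Q B \<longrightarrow> card E \<le> length B"
  proof (rule ccontr)
    assume "\<not> ?thesis"
    then obtain f where f: "\<And>X. X \<subseteq> E \<Longrightarrow> ft_reachability_oracle 1 (G X) P Q (f X)"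
      and short: "\<And>X. X \<subseteq> E \<Longrightarrow> length (f X) < card E"
      by (metis not_le)
    obtain X Y where XY: "X \<subseteq> E" "Y \<subseteq> E" "f X = f Y" and "\<not> X \<subseteq> Y"
      by (rule short_encoding_collision[OF finE short, of id]) auto
    then obtain u v where e: "(u, v) \<in> X" "(u, v) \<notin> Y"
      by auto
    with XY crit obtain s t where st: "(s, t) \<in> R" "critical_edge E (u, v) (s, t)"
      by fast
    \<comment> \<open>All base edges are present in every \<open>G Z\<close>, so this one deletion
      is a legal query for both \<open>X\<close> and \<open>Y\<close>.\<close>
    define F where "F = {(g (u, False), g (v, False))}"
    have "Q (f Z) (g (s, False), g (t, False)) F \<longleftrightarrow> (u, v) \<in> Z" if "Z \<subseteq> E" for Z
    proof -
      have "Q (f Z) (g (s, False), g (t, False)) F \<longleftrightarrow>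
          g (s, False) \<rightarrow>\<^sup>*\<^bsub>with_proj (delete_edges (G Z) F)\<^esub> g (t, False)"
      proof -
        have "(g (s, False), g (t, False)) \<in> P"
          using st P by (auto simp: P\<^sub>0_def)
        moreover have "F \<subseteq> parcs (G Z)"
          using e XY by (auto simp: F_def G_def twin_arcs_def)
        moreover have "card F \<le> 1"
          by (simp add: F_def)
        ultimately show ?thesis
          using f[OF that] unfolding ft_reachability_oracle_def by blast
      qed
      also have "\<dots> \<longleftrightarrow> g (s, False) \<in> {..<n} \<and>
          (g (s, False), g (t, False)) \<in> (twin_arcs g V E Z - F)\<^sup>*"
        using G[OF that] reachable_with_proj_iff[of "G Z"]
        by (simp add: pair_fin_digraph_def G_def)
      also have "\<dots> \<longleftrightarrow> (u, v) \<in> Z"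
        using twin_arcs_reachable_iff[OF inj E that, of u v s t] st e XY R g unfolding F_def by blast
      finally show ?thesis .
    qed
    with XY e show False
      by metis
  qed
  then obtain X where X: "X \<subseteq> E" "\<forall>B. ft_reachability_oracle 1 (G X) P Q B \<longrightarrow> card E \<le> length B"
    by blast
  show ?thesis
    unfolding oracle_bound_def
    by (rule exI[of _ "G X"], rule exI[of _ P]) (use X G P in \<open>auto simp: G_def\<close>)
qed

section \<open>Single arcs, paths and bipartite graphs\<close>

text \<open>Diagonalisation: the arc is present exactly when \<open>Q\<close>, given the empty
  string, denies reachability. This serves \<open>n < 4\<close>, where twinning leaves room for only
  one base vertex.\<close>

lemma oracle_bound_one:
  assumes "2 \<le> n" "1 \<le> p" "p \<le> n\<^sup>2"
  shows "oracle_bound n p Q 1"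
proof -
  have "{(0, 1)} \<subseteq> {..<n} \<times> {..<n}" "card {(0 :: nat, 1 :: nat)} \<le> p" "p \<le> card ({..<n} \<times> {..<n})"
    using assms by (auto simp: power2_eq_square)
  then obtain P where P: "{(0, 1)} \<subseteq> P" "P \<subseteq> {..<n} \<times> {..<n}" "card P = p"
    by (metis exists_subset_between finite_SigmaI finite_lessThan)
  define G where "G = \<lparr>pverts = {..<n}, parcs = (if Q [] (0, 1) {} then {} else {(0, 1)})\<rparr>"
  have G: "pair_fin_digraph G"
    using assms(1) by unfold_locales (auto simp: G_def split: if_splits)
  have "\<not> ft_reachability_oracle 1 G P Q []"
  proof
    assume "ft_reachability_oracle 1 G P Q []"
    hence "Q [] (0, 1) {} \<longleftrightarrow> 0 \<rightarrow>\<^sup>*\<^bsub>with_proj (delete_edges G {})\<^esub> 1"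
      using P(1) unfolding ft_reachability_oracle_def by fastforce
    also have "\<dots> \<longleftrightarrow> (0, 1) \<in> (parcs G)\<^sup>*"
      using G reachable_with_proj_iff[of G] assms(1) by (simp add: pair_fin_digraph_def G_def)
    also have "\<dots> \<longleftrightarrow> \<not> Q [] (0, 1) {}"
      by (auto simp: G_def)
    finally show False by blast
  qed
  hence "\<forall>B. ft_reachability_oracle 1 G P Q B \<longrightarrow> 1 \<le> length B"
    by (metis One_nat_def Suc_leI length_greater_0_conv)
  thus ?thesis
    unfolding oracle_bound_def using G P
    by (intro exI[of _ G] exI[of _ P]) (simp add: G_def)
qed

lemma card_edges_path: "card ((\<lambda>i. (i, Suc i)) ` {..<r}) = r"
  by (subst card_image) (auto simp: inj_on_def)

lemma critical_edge_path:
  assumes "i < r"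
  shows "critical_edge ((\<lambda>i. (i, Suc i)) ` {..<r}) (i, Suc i) (0, r)"
proof -
  let ?E = "(\<lambda>i. (i, Suc i)) ` {..<r}"
  have "(0, j) \<in> ?E\<^sup>*" if "j \<le> r" for j
    using that
  proof (induction j)
    case (Suc j)
    hence "(0, j) \<in> ?E\<^sup>*" "(j, Suc j) \<in> ?E" by auto
    thus ?case by (rule rtrancl_into_rtrancl)
  qed simp
  \<comment> \<open>Without its only outgoing edge, the initial segment up to \<open>i\<close>
    cannot be left.\<close>
  moreover have "y \<le> i" if "(0, y) \<in> (?E - {(i, Suc i)})\<^sup>*" for y
    using that by (induction rule: rtrancl_induct) auto
  ultimately show ?thesis
    using assms by (fastforce simp: critical_edge_def)
qed

lemma oracle_bound_path:
  assumes "2 * (r + 1) \<le> n" "1 \<le> p" "p \<le> n\<^sup>2"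
  shows "oracle_bound n p Q r"
proof -
  have "oracle_bound n p Q (card ((\<lambda>i. (i, Suc i)) ` {..<r}))"
    using assms by (intro oracle_bound_of_critical_edges[where V = "{..r}" and R = "{(0, r)}"])
      (auto intro: critical_edge_path)
  thus ?thesis
    by (simp add: card_edges_path)
qed

text \<open>All edges go from left to right, so no two can be composed and each edge is the only
  path between its ends. The edges themselves serve as the pairs.\<close>

lemma oracle_bound_bipartite:
  assumes "4 * r \<le> n" "m \<le> r\<^sup>2" "m \<le> p" "p \<le> n\<^sup>2"
  shows "oracle_bound n p Q m"
proof -
  have "m \<le> card ({..<r} \<times> {r..<2 * r})"
    using assms(2) by (simp add: power2_eq_square)
  then obtain E where E: "E \<subseteq> {..<r} \<times> {r..<2 * r}" "card E = m"
    by (metis obtain_subset_with_card_n)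
  have "critical_edge E e e" if "e \<in> E" for e
  proof -
    obtain s t where st: "e = (s, t)" by fastforce
    have "s < r" "r \<le> t"
      using that E st by auto
    have "y = s \<or> (s, y) \<in> E - {(s, t)}" if "(s, y) \<in> (E - {(s, t)})\<^sup>*" for y
      using that
    proof (induction rule: rtrancl_induct)
      case (step y z)
      hence "y < r" "(s, y) \<in> E \<Longrightarrow> r \<le> y"
        using E by auto
      with step show ?case by auto
    qed simp
    from this[of t] show ?thesis
      using that st \<open>s < r\<close> \<open>r \<le> t\<close> by (auto simp: critical_edge_def)
  qed
  hence "oracle_bound n p Q (card E)"
    using assms E
    by (intro oracle_bound_of_critical_edges[where V = "{..<2 * r}" and R = E]) (fastforce)+
  thus ?thesis
    using E by simp
qed

section \<open>Lattice lines with directions on a paraboloid\<close>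

text \<open>A vertex consists of a layer, \<open>k\<close> coordinates and a last coordinate that
  moves by |w|^2 per layer. \<open>restrict\<close> fixes the values outside \<open>{..<k}\<close>,
  so that equal points are equal as functions.\<close>

definition lattice_line :: "nat \<Rightarrow> (nat \<Rightarrow> nat) \<Rightarrow> nat \<Rightarrow> (nat \<Rightarrow> nat) \<Rightarrow> nat \<Rightarrow> nat \<times> (nat \<Rightarrow> nat) \<times> nat"
  where "lattice_line k x z w l =
    (l, restrict (\<lambda>i. x i + l * w i) {..<k}, z + l * (\<Sum>i<k. (w i)\<^sup>2))"

definition lattice_edge where
  "lattice_edge k = (\<lambda>(x, z, w, l). (lattice_line k x z w l, lattice_line k x z w (Suc l)))"

definition lattice_pair where
  "lattice_pair k L = (\<lambda>(x, z, w). (lattice_line k x z w 0, lattice_line k x z w L))"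

text \<open>
  Along an edge of direction \<open>w'\<close> the potential relative to the line of direction \<open>w\<close> increases
  by \<open>\<bar>w - w'\<bar>\<^sup>2\<close>, so it stays zero only along that line.
\<close>

definition lattice_potential ::
    "nat \<Rightarrow> (nat \<Rightarrow> nat) \<Rightarrow> nat \<Rightarrow> (nat \<Rightarrow> nat) \<Rightarrow> nat \<times> (nat \<Rightarrow> nat) \<times> nat \<Rightarrow> int" where
  "lattice_potential k x z w = (\<lambda>(l, y, v). int v - int z
     - 2 * (\<Sum>i<k. int (w i) * (int (y i) - int (x i))) + int l * (\<Sum>i<k. (int (w i))\<^sup>2))"

lemma lattice_potential_line:
  "lattice_potential k x z w (lattice_line k x z w l) = 0"
proof -
  have "(\<Sum>i<k. int (w i) * (int (x i + l * w i) - int (x i))) = int l * (\<Sum>i<k. (int (w i))\<^sup>2)"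
    by (auto simp: sum_distrib_left power2_eq_square intro!: sum.cong)
  thus ?thesis
    by (simp add: lattice_potential_def lattice_line_def)
qed

lemma lattice_potential_step:
  "lattice_potential k x z w (lattice_line k x' z' w' (Suc l)) =
   lattice_potential k x z w (lattice_line k x' z' w' l) + (\<Sum>i<k. (int (w i) - int (w' i))\<^sup>2)"
proof -
  have "(\<Sum>i<k. int (w i) * (int (x' i + Suc l * w' i) - int (x i))) =
      (\<Sum>i<k. int (w i) * (int (x' i + l * w' i) - int (x i))) + (\<Sum>i<k. int (w i) * int (w' i))"
    by (simp add: sum.distrib[symmetric] algebra_simps)
  moreover have "(\<Sum>i<k. (int (w i) - int (w' i))\<^sup>2) =
      (\<Sum>i<k. (int (w i))\<^sup>2) + (\<Sum>i<k. (int (w' i))\<^sup>2) - 2 * (\<Sum>i<k. int (w i) * int (w' i))"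
    by (simp add: power2_diff sum.distrib sum_subtractf sum_distrib_left mult.assoc)
  ultimately show ?thesis
    by (simp add: lattice_potential_def lattice_line_def algebra_simps)
qed

text \<open>A point and a direction determine the next point. This is needed because an edge leaving
  the reference line is known only through its own parameters.\<close>

lemma lattice_line_cong:
  assumes "lattice_line k x z w l = lattice_line k x' z' w l'"
  shows "lattice_line k x z w (Suc l) = lattice_line k x' z' w (Suc l')"
proof -
  have "restrict (\<lambda>i. x i + l * w i) {..<k} = restrict (\<lambda>i. x' i + l' * w i) {..<k}"
    using assms unfolding lattice_line_def prod.inject by blast
  hence "x i + l * w i = x' i + l' * w i" if "i < k" for i
    using that by (auto dest: fun_cong[of _ _ i])
  thus ?thesis
    using assms by (auto simp: lattice_line_def fun_eq_iff)
qed

text \<open>The ranges of \<open>x\<close> and \<open>z\<close> match the largest displacement over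
  \<open>L\<close> layers: \<open>a * L\<close> per coordinate and \<open>k * a\<^sup>2 * L\<close>
  in the last. Hence a box of twice the side holds all lines, at the cost of a constant
  factor.\<close>

definition lattice_params :: "nat \<Rightarrow> nat \<Rightarrow> nat \<Rightarrow> ((nat \<Rightarrow> nat) \<times> nat \<times> (nat \<Rightarrow> nat)) set" where
  "lattice_params k a L = (PiE {..<k} (\<lambda>_. {..<a * L})) \<times> {..<k * a\<^sup>2 * L} \<times> (PiE {..<k} (\<lambda>_. {..<a}))"

definition lattice_edge_params where
  "lattice_edge_params k a L = {(x, z, w, l). (x, z, w) \<in> lattice_params k a L \<and> l < L}"

definition lattice_verts :: "nat \<Rightarrow> nat \<Rightarrow> nat \<Rightarrow> (nat \<times> (nat \<Rightarrow> nat) \<times> nat) set" where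
  "lattice_verts k a L =
     {..L} \<times> (PiE {..<k} (\<lambda>_. {..<2 * (a * L)})) \<times> {..<2 * (k * a\<^sup>2 * L)}"

text \<open>The end of the line has potential zero and potential never falls, so a walk to it uses
  only edges of direction \<open>w\<close> and stays on the line. Without the edge at layer
  \<open>l\<close> such a walk cannot pass that layer.\<close>

lemma critical_edge_lattice:
  assumes w: "(x, z, w) \<in> lattice_params k a L" and "l < L"
  shows "critical_edge (lattice_edge k ` lattice_edge_params k a L)
      (lattice_edge k (x, z, w, l)) (lattice_pair k L (x, z, w))"
proof -
  let ?E = "lattice_edge k ` lattice_edge_params k a L" and ?e = "lattice_edge k (x, z, w, l)"
  let ?line = "lattice_line k x z w" and ?\<phi> = "lattice_potential k x z w"
  have "(?line 0, ?line j) \<in> ?E\<^sup>*" if "j \<le> L" for j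
    using that
  proof (induction j)
    case (Suc j)
    hence "(x, z, w, j) \<in> lattice_edge_params k a L"
      using w by (simp add: lattice_edge_params_def)
    hence "(?line j, ?line (Suc j)) \<in> ?E"
      by (force simp: lattice_edge_def image_iff)
    with Suc show ?case by (meson Suc_leD rtrancl_into_rtrancl)
  qed simp
  moreover have "?\<phi> y \<ge> 0 \<and> (?\<phi> y = 0 \<longrightarrow> (\<exists>j\<le>l. y = ?line j))"
    if "(?line 0, y) \<in> (?E - {?e})\<^sup>*" for y
    using that
  proof (induction rule: rtrancl_induct)
    case base
    thus ?case by (auto simp: lattice_potential_line)
  next
    case (step y y')
    then obtain x' z' w' l' where par: "(x', z', w', l') \<in> lattice_edge_params k a L"
      and y: "y = lattice_line k x' z' w' l'" and y': "y' = lattice_line k x' z' w' (Suc l')"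
      by (auto simp: lattice_edge_def)
    have \<phi>: "?\<phi> y' = ?\<phi> y + (\<Sum>i<k. (int (w i) - int (w' i))\<^sup>2)"
      by (simp add: y y' lattice_potential_step)
    have nonneg: "(\<Sum>i<k. (int (w i) - int (w' i))\<^sup>2) \<ge> 0"
      by (simp add: sum_nonneg)
    have "\<exists>j\<le>l. y' = ?line j" if "?\<phi> y' = 0"
    proof -
      have "?\<phi> y = 0" and "(\<Sum>i<k. (int (w i) - int (w' i))\<^sup>2) = 0"
        using that \<phi> nonneg step.IH by auto
      hence "\<And>i. i < k \<Longrightarrow> w i = w' i"
        by (simp add: sum_nonneg_eq_0_iff)
      \<comment> \<open>Agreement below \<open>k\<close> is enough, since both directions are
        extensional.\<close>
      hence w': "w' = w"
        using w par by (intro PiE_ext[of w' "{..<k}" "\<lambda>_. {..<a}" w])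
          (auto simp: lattice_params_def lattice_edge_params_def)
      from step.IH \<open>?\<phi> y = 0\<close> obtain j where j: "j \<le> l" "y = ?line j" by auto
      hence "y' = ?line (Suc j)"
        using lattice_line_cong y y' w' by metis
      \<comment> \<open>From layer \<open>l\<close> this step would be the deleted edge.\<close>
      moreover have "j \<noteq> l"
        using calculation j step.hyps(2) by (auto simp: lattice_edge_def)
      ultimately show ?thesis
        using j by (auto intro!: exI[of _ "Suc j"])
    qed
    thus ?case
      using \<phi> nonneg step.IH by auto
  qed
  moreover have "?line L \<noteq> ?line j" if "j \<le> l" for j
    using that \<open>l < L\<close> by (simp add: lattice_line_def)
  ultimately have "(?line 0, ?line L) \<in> ?E\<^sup>*" "(?line 0, ?line L) \<notin> (?E - {?e})\<^sup>*"
    using lattice_potential_line[of k x z w L] by blast+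
  thus ?thesis
    by (simp add: critical_edge_def lattice_pair_def)
qed

text \<open>The two ends of an edge give the layer, their difference gives \<open>w\<close>, and
  going back \<open>l\<close> layers gives the start. So different lines share no edge, and edges
  may be counted by parameters.\<close>

lemma inj_on_lattice_edge: "inj_on (lattice_edge k) (lattice_edge_params k a L)"
proof (rule inj_onI)
  fix e e'
  assume e: "e \<in> lattice_edge_params k a L" "e' \<in> lattice_edge_params k a L"
    "lattice_edge k e = lattice_edge k e'"
  obtain x z w l x' z' w' l' where ee: "e = (x, z, w, l)" "e' = (x', z', w', l')"
    by (metis prod_cases4)
  note par = e(1,2)[unfolded ee] and eq = e(3)[unfolded ee]
  have l: "l = l'"
    and r: "restrict (\<lambda>i. x i + l * w i) {..<k} = restrict (\<lambda>i. x' i + l * w' i) {..<k}"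
      "restrict (\<lambda>i. x i + Suc l * w i) {..<k} = restrict (\<lambda>i. x' i + Suc l * w' i) {..<k}"
    and z: "z + l * (\<Sum>i<k. (w i)\<^sup>2) = z' + l * (\<Sum>i<k. (w' i)\<^sup>2)"
    using eq by (auto simp: lattice_edge_def lattice_line_def)
  have "w i = w' i \<and> x i = x' i" if "i < k" for i
  proof -
    have "x i + l * w i = x' i + l * w' i" "x i + Suc l * w i = x' i + Suc l * w' i"
      using r[THEN fun_cong, of i] that by auto
    moreover from this have "w i = w' i"
      by simp
    ultimately show ?thesis by simp
  qed
  hence "w = w'" "x = x'"
    using par by (auto simp: lattice_params_def lattice_edge_params_def
      intro: PiE_ext[of w "{..<k}" "\<lambda>_. {..<a}" w'] PiE_ext[of x "{..<k}" "\<lambda>_. {..<a * L}" x'])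
  thus "e = e'"
    using l z ee by simp
qed

text \<open>The \<open>a ^ k\<close> directions multiply the \<open>(a * L) ^ k\<close> choices of
  \<open>x\<close>, which makes \<open>a\<^sup>2 * L\<close> the counterpart of
  \<open>q\<close>.\<close>

lemma card_lattice_params: "card (lattice_params k a L) = k * (a\<^sup>2 * L) ^ Suc k"
  by (simp add: lattice_params_def card_cartesian_product card_PiE power_mult_distrib
      power2_eq_square mult_ac)

lemma finite_lattice_params: "finite (lattice_params k a L)"
  by (simp add: lattice_params_def finite_PiE)

lemma card_lattice_edge_params:
  "card (lattice_edge_params k a L) = L * (k * (a\<^sup>2 * L) ^ Suc k)"
proof -
  have "lattice_edge_params k a L =
      (\<lambda>((x, z, w), l). (x, z, w, l)) ` (lattice_params k a L \<times> {..<L})"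
    by (force simp: lattice_edge_params_def)
  moreover have "inj_on (\<lambda>((x, z, w), l). (x, z, w, l)) (lattice_params k a L \<times> {..<L})"
    by (auto simp: inj_on_def)
  ultimately show ?thesis
    by (simp add: card_image card_cartesian_product card_lattice_params)
qed

lemma card_lattice_verts:
  assumes "1 \<le> L"
  shows "card (lattice_verts k a L) \<le> 2 ^ (k + 2) * k * (a * L) ^ (k + 2)"
proof -
  have "card (lattice_verts k a L) = (L + 1) * ((2 * (a * L)) ^ k * (2 * (k * a\<^sup>2 * L)))"
    by (simp add: lattice_verts_def card_cartesian_product card_PiE)
  also have "\<dots> \<le> (2 * L) * ((2 * (a * L)) ^ k * (2 * (k * a\<^sup>2 * L)))"
    using assms by (intro mult_right_mono) auto
  also have "\<dots> = 2 ^ (k + 2) * k * (a * L) ^ (k + 2)"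
    by (simp add: power_mult_distrib power2_eq_square power_add mult_ac)
  finally show ?thesis .
qed

lemma lattice_line_in_verts:
  assumes "(x, z, w) \<in> lattice_params k a L" "l \<le> L"
  shows "lattice_line k x z w l \<in> lattice_verts k a L"
proof -
  have w: "w i < a" and x: "x i < a * L" if "i < k" for i
    using assms that by (auto simp: lattice_params_def dest: PiE_mem)
  have "x i + l * w i < 2 * (a * L)" if "i < k" for i
  proof -
    have "l * w i \<le> L * a"
      using w[OF that] assms(2) by (intro mult_le_mono) auto
    thus ?thesis
      using x[OF that] by (simp add: mult.commute)
  qed
  moreover have "l * (\<Sum>i<k. (w i)\<^sup>2) \<le> L * (k * a\<^sup>2)"
  proof (rule mult_le_mono[OF assms(2)])
    have "(\<Sum>i<k. (w i)\<^sup>2) \<le> (\<Sum>i<k. a\<^sup>2)"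
      using w by (intro sum_mono power_mono) (auto intro: less_imp_le)
    thus "(\<Sum>i<k. (w i)\<^sup>2) \<le> k * a\<^sup>2" by simp
  qed
  moreover have "z < k * a\<^sup>2 * L"
    using assms by (simp add: lattice_params_def)
  ultimately show ?thesis
    using assms(2) by (auto simp: lattice_verts_def lattice_line_def mult_ac)
qed

lemma oracle_bound_lattice:
  assumes "1 \<le> L" and n: "2 * (2 ^ (k + 2) * k * (a * L) ^ (k + 2)) \<le> n"
    and p: "k * (a\<^sup>2 * L) ^ Suc k \<le> p" "p \<le> n\<^sup>2"
  shows "oracle_bound n p Q (L * (k * (a\<^sup>2 * L) ^ Suc k))"
proof -
  have "oracle_bound n p Q (card (lattice_edge k ` lattice_edge_params k a L))"
  proof (rule oracle_bound_of_critical_edges)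
    show "finite (lattice_verts k a L)"
      by (simp add: lattice_verts_def finite_PiE)
    show "lattice_edge k ` lattice_edge_params k a L \<subseteq> lattice_verts k a L \<times> lattice_verts k a L"
      by (auto simp: lattice_edge_def lattice_edge_params_def intro!: lattice_line_in_verts)
    show "lattice_pair k L ` lattice_params k a L \<subseteq> lattice_verts k a L \<times> lattice_verts k a L"
      by (auto simp: lattice_pair_def intro!: lattice_line_in_verts)
    show "2 * card (lattice_verts k a L) \<le> n"
      using card_lattice_verts[OF assms(1), of k a] n by linarith
    show "card (lattice_pair k L ` lattice_params k a L) \<le> p"
      using card_image_le[OF finite_lattice_params, of "lattice_pair k L" k a L] p
      by (simp add: card_lattice_params)
    fix e assume "e \<in> lattice_edge k ` lattice_edge_params k a L"
    thus "\<exists>r\<in>lattice_pair k L ` lattice_params k a L.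
        critical_edge (lattice_edge k ` lattice_edge_params k a L) e r"
      by (fastforce simp: lattice_edge_params_def intro: critical_edge_lattice[unfolded lattice_edge_params_def])
  qed (fact p)
  thus ?thesis
    by (simp add: card_image[OF inj_on_lattice_edge] card_lattice_edge_params)
qed

section \<open>Choice of parameters\<close>

lemma half_le_floor:
  assumes "(1 :: real) \<le> x"
  shows "x / 2 \<le> real (nat \<lfloor>x\<rfloor>)" "real (nat \<lfloor>x\<rfloor>) \<le> x" "1 \<le> nat \<lfloor>x\<rfloor>"
proof -
  have "1 \<le> \<lfloor>x\<rfloor>"
    using assms by simp
  moreover have "of_int \<lfloor>x\<rfloor> \<le> x" "x < of_int \<lfloor>x\<rfloor> + 1"
    by linarith+
  ultimately show "x / 2 \<le> real (nat \<lfloor>x\<rfloor>)" "real (nat \<lfloor>x\<rfloor>) \<le> x" "1 \<le> nat \<lfloor>x\<rfloor>"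
    by (simp_all add: le_nat_iff, linarith?)
qed

text \<open>The target N^2 q^k is at most N^(k+2), hence at most \<open>n\<close>, if
  \<open>q \<le> N\<close>, and at most q^(k+1), hence at most \<open>p\<close>, if
  \<open>N\<^sup>2 \<le> q\<close>. In between, the lattice has about q^(k+1) lines of about N^2 / q
  edges each.\<close>

lemma oracle_bound_cases:
  fixes N q :: real
  assumes k: "1 \<le> k" and "4 \<le> n" and p: "1 \<le> p" "p \<le> n\<^sup>2" and pos: "0 < N" "0 < q"
    and n: "2 * (2 ^ (k + 2) * real k * N ^ (k + 2)) = real n"
    and pq: "real k * q ^ Suc k = real p"
  shows "\<exists>m. oracle_bound n p Q m \<and> N\<^sup>2 * q ^ k \<le> 2 * 8 ^ Suc k * real m"
proof -
  \<comment> \<open>The constant is dictated by the lattice case; being at least 64, it also absorbs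
    the losses 6 and 64 of the path and the bipartite graph.\<close>
  have C: "64 \<le> (2 * 8 ^ Suc k :: real)"
    using power_increasing[of 2 "Suc k" "8 :: real"] k by simp
  consider "q \<le> N" | "N\<^sup>2 \<le> q" | "N < q" "q < N\<^sup>2" by linarith
  thus ?thesis
  proof cases
    case 1
    \<comment> \<open>The longest path whose \<open>r + 1\<close> vertices and their twins fit into
      \<open>n\<close>.\<close>
    define r where "r = n div 2 - 1"
    have "oracle_bound n p Q r"
      using \<open>4 \<le> n\<close> p by (intro oracle_bound_path) (auto simp: r_def)
    have "n \<le> 6 * r"
      using \<open>4 \<le> n\<close> unfolding r_def by presburger
    have "N\<^sup>2 * q ^ k \<le> N\<^sup>2 * N ^ k"
      using 1 pos by (intro mult_left_mono power_mono) auto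
    also have "\<dots> = 1 * N ^ (k + 2)"
      by (simp add: power_add power2_eq_square)
    also have "\<dots> \<le> (2 * 2 ^ (k + 2) * real k) * N ^ (k + 2)"
    proof (intro mult_right_mono)
      have "1 * 1 \<le> 2 ^ (k + 3) * real k"
        using k by (intro mult_mono one_le_power) auto
      thus "1 \<le> 2 * 2 ^ (k + 2) * real k" by (simp add: power_add)
    qed (use pos in auto)
    also have "\<dots> = real n"
      using n by (simp add: mult.assoc)
    also have "\<dots> \<le> 6 * real r"
      using \<open>n \<le> 6 * r\<close> by linarith
    also have "\<dots> \<le> 2 * 8 ^ Suc k * real r"
      using C by (intro mult_right_mono) auto
    finally show ?thesis
      using \<open>oracle_bound n p Q r\<close> by blast
  next
    case 2
    define r where "r = n div 4"
    define m where "m = min p (r\<^sup>2)"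
    have "oracle_bound n p Q m"
      using p by (intro oracle_bound_bipartite[of r]) (auto simp: r_def m_def)
    have "n \<le> 8 * r"
      using \<open>4 \<le> n\<close> unfolding r_def by presburger
    hence "n\<^sup>2 \<le> 64 * r\<^sup>2"
      using power_mono[of n "8 * r" 2] by (simp add: power_mult_distrib)
    hence "p \<le> 64 * m"
      using p by (auto simp: m_def min_def)
    have "N\<^sup>2 * q ^ k \<le> q * q ^ k"
      using 2 pos by (intro mult_right_mono) auto
    also have "\<dots> = 1 * q ^ Suc k"
      by simp
    also have "\<dots> \<le> real k * q ^ Suc k"
      using k pos by (intro mult_right_mono) auto
    also have "\<dots> \<le> 64 * real m"
      using \<open>p \<le> 64 * m\<close> pq by linarith
    also have "\<dots> \<le> 2 * 8 ^ Suc k * real m"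
      using C by (intro mult_right_mono) auto
    finally show ?thesis
      using \<open>oracle_bound n p Q m\<close> by blast
  next
    case 3
    \<comment> \<open>These solve \<open>a * L = N\<close> and \<open>a\<^sup>2 * L = q\<close> up
      to rounding. Both quotients exceed 1 in this case, so each floor loses at most a factor
      2.\<close>
    define a where "a = nat \<lfloor>q / N\<rfloor>"
    define L where "L = nat \<lfloor>N\<^sup>2 / q\<rfloor>"
    have a: "q / N / 2 \<le> real a" "real a \<le> q / N"
      using half_le_floor[of "q / N"] 3 pos by (simp_all add: a_def)
    have L: "N\<^sup>2 / q / 2 \<le> real L" "real L \<le> N\<^sup>2 / q" "1 \<le> L"
      using half_le_floor[of "N\<^sup>2 / q"] 3 pos by (simp_all add: L_def)
    have aL: "real (a * L) \<le> N"
    proof -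
      have "real a * real L \<le> q / N * (N\<^sup>2 / q)"
        using a L pos by (intro mult_mono) auto
      thus ?thesis
        using pos by (simp add: power2_eq_square)
    qed
    have aaL: "real (a\<^sup>2 * L) \<le> q"
    proof -
      have "(real a)\<^sup>2 * real L \<le> (q / N)\<^sup>2 * (N\<^sup>2 / q)"
        using a L pos by (intro mult_mono power_mono) auto
      thus ?thesis
        using pos by (simp add: power2_eq_square field_simps)
    qed
    have aaL': "q / 8 \<le> real (a\<^sup>2 * L)"
    proof -
      have "(q / N / 2)\<^sup>2 * (N\<^sup>2 / q / 2) \<le> (real a)\<^sup>2 * real L"
        using a L pos by (intro mult_mono power_mono) auto
      thus ?thesis
        using pos by (simp add: power2_eq_square field_simps)
    qed
    define m where "m = L * (k * (a\<^sup>2 * L) ^ Suc k)"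
    have "oracle_bound n p Q m"
      unfolding m_def
    proof (rule oracle_bound_lattice)
      have "2 * (2 ^ (k + 2) * real k * real (a * L) ^ (k + 2)) \<le> real n"
        unfolding n[symmetric] using aL by (intro mult_left_mono power_mono) auto
      hence "real (2 * (2 ^ (k + 2) * k * (a * L) ^ (k + 2))) \<le> real n"
        by simp
      thus "2 * (2 ^ (k + 2) * k * (a * L) ^ (k + 2)) \<le> n"
        by (simp only: of_nat_le_iff)
      have "real k * real (a\<^sup>2 * L) ^ Suc k \<le> real p"
        unfolding pq[symmetric] using aaL by (intro mult_left_mono power_mono) auto
      hence "real (k * (a\<^sup>2 * L) ^ Suc k) \<le> real p"
        by simp
      thus "k * (a\<^sup>2 * L) ^ Suc k \<le> p"
        by (simp only: of_nat_le_iff)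
    qed (use L p in auto)
    moreover have "N\<^sup>2 * q ^ k \<le> 2 * 8 ^ Suc k * real m"
    proof -
      \<comment> \<open>The 2 pays for rounding \<open>L\<close>, each 8 for rounding the three
        factors of \<open>a\<^sup>2 * L\<close>; the 1 is a lower bound for
        \<open>k\<close>.\<close>
      have "N\<^sup>2 * q ^ k = 2 * 8 ^ Suc k * (N\<^sup>2 / q / 2 * (1 * (q / 8) ^ Suc k))"
        using pos by (simp add: power_divide field_simps)
      also have "\<dots> \<le> 2 * 8 ^ Suc k * (real L * (real k * real (a\<^sup>2 * L) ^ Suc k))"
        using L aaL' k pos by (intro mult_left_mono mult_mono power_mono) auto
      also have "\<dots> = 2 * 8 ^ Suc k * real m"
        by (simp add: m_def)
      finally show ?thesis .
    qed
    ultimately show ?thesis by blast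
  qed
qed

lemma powr_inverse_power:
  assumes "0 < (x :: real)" "0 < m"
  shows "(x powr (1 / real m)) ^ m = x"
  using assms by (simp add: powr_realpow[symmetric] powr_powr)

theorem theorem1p4:
  fixes d :: nat
  assumes "d \<ge> 2"
  shows "\<exists>c > 0. \<forall>n \<ge> 2. \<forall>p \<le> n ^ 2. \<forall>Q :: nat query_procedure.
    \<exists>(G :: nat pair_pre_digraph) P.
      pair_fin_digraph G \<and> pverts G = {..<n} \<and>
      P \<subseteq> pverts G \<times> pverts G \<and> card P = p \<and>
      (\<forall>B. ft_reachability_oracle 1 G P Q B \<longrightarrow>
         real (length B) \<ge> c * (real n powr (2 / (real d + 1)) * real p powr ((real d - 1) / real d)))"
proof -
  define k where "k = d - 1"
  have k: "1 \<le> k" "d = Suc k"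
    using assms by (auto simp: k_def)
  \<comment> \<open>\<open>K\<close> is chosen so that \<open>n\<close> equals K N^(k+2);
    \<open>D\<close> collects the constants left when the target is written as a multiple of N^2
    q^k.\<close>
  define K :: real where "K = 2 * (2 ^ (k + 2) * real k)"
  define D :: real where "D = K powr (2 / real (k + 2)) * real k powr (real k / real (Suc k))"
  \<comment> \<open>The value 1/27 serves \<open>n < 4\<close>, where the target is at most 3 * 9;
    the other term comes from \<open>oracle_bound_cases\<close>.\<close>
  define c where "c = min (1 / 27) (1 / (D * (2 * 8 ^ Suc k)))"
  have "0 < K" "0 < D"
    using k by (auto simp: K_def D_def)
  hence "0 < c"
    by (simp add: c_def)
  define T where "T n p = real n powr (2 / (real d + 1)) * real p powr ((real d - 1) / real d)" for n p
  have main: "\<exists>m. oracle_bound n p Q m \<and> c * T n p \<le> real m"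
    if n: "2 \<le> n" and p: "p \<le> n\<^sup>2" "1 \<le> p" for n p Q
  proof (cases "4 \<le> n")
    case True
    define N where "N = (real n / K) powr (1 / real (k + 2))"
    define q where "q = (real p / real k) powr (1 / real (Suc k))"
    have N: "0 < N" "N ^ (k + 2) = real n / K"
      using n \<open>0 < K\<close> powr_inverse_power[of "real n / K" "k + 2"] by (simp_all add: N_def)
    have q: "0 < q" "q ^ Suc k = real p / real k"
      using p k powr_inverse_power[of "real p / real k" "Suc k"] by (simp_all add: q_def)
    have "real n powr (2 / (real d + 1)) = K powr (2 / real (k + 2)) * N\<^sup>2"
    proof -
      have "N\<^sup>2 = (real n / K) powr (2 / real (k + 2))"
        using n \<open>0 < K\<close> by (simp add: N_def powr_realpow[symmetric] powr_powr)
      thus ?thesis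
        using \<open>0 < K\<close> by (simp add: powr_divide k add.commute)
    qed
    moreover have "real p powr ((real d - 1) / real d) = real k powr (real k / real (Suc k)) * q ^ k"
    proof -
      have "q ^ k = (real p / real k) powr (real k / real (Suc k))"
        using p k(1) by (simp add: q_def powr_realpow[symmetric] powr_powr)
      thus ?thesis
        using k(1) by (simp add: powr_divide k(2))
    qed
    ultimately have T: "T n p = D * (N\<^sup>2 * q ^ k)"
      by (simp add: T_def D_def mult_ac)
    obtain m where m: "oracle_bound n p Q m" "N\<^sup>2 * q ^ k \<le> 2 * 8 ^ Suc k * real m"
      using oracle_bound_cases[OF k(1) True p(2,1) N(1) q(1), of Q] N(2) q(2) \<open>0 < K\<close> k(1)
      by (auto simp: K_def mult.assoc)
    have "c * T n p \<le> 1 / (D * (2 * 8 ^ Suc k)) * (D * (N\<^sup>2 * q ^ k))"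
      unfolding T c_def using \<open>0 < D\<close> N q by (intro mult_right_mono) auto
    also have "\<dots> \<le> 1 / (D * (2 * 8 ^ Suc k)) * (D * (2 * 8 ^ Suc k * real m))"
      using m(2) \<open>0 < D\<close> by (intro mult_left_mono) auto
    also have "\<dots> = real m"
      using \<open>0 < D\<close> by simp
    finally show ?thesis
      using m by blast
  next
    case False
    have "real n powr (2 / (real d + 1)) \<le> real n powr 1"
      using assms n by (intro powr_mono) auto
    moreover have "real p powr ((real d - 1) / real d) \<le> real p powr 1"
      using assms p by (intro powr_mono) auto
    moreover have "p \<le> 3\<^sup>2"
      using p False power_mono[of n 3 2] by linarith
    ultimately have "T n p \<le> 3 * 9"
      unfolding T_def using False by (intro mult_mono) auto
    moreover have "c * T n p \<le> 1 / 27 * T n p"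
      unfolding c_def by (intro mult_right_mono) (auto simp: T_def)
    ultimately have "c * T n p \<le> real 1"
      by simp
    thus ?thesis
      using oracle_bound_one[OF n p(2,1)] by blast
  qed
  have "\<exists>m. oracle_bound n p Q m \<and> c * T n p \<le> real m" if "2 \<le> n" "p \<le> n\<^sup>2" for n p Q
  proof (cases "p = 0")
    case True
    \<comment> \<open>With no pairs the target vanishes, since \<open>0 powr x = 0\<close>, and the
      empty base graph suffices.\<close>
    hence "oracle_bound n p Q (card ({} :: nat rel))"
      by (intro oracle_bound_of_critical_edges[where V = "{} :: nat set" and R = "{} :: nat rel"]) auto
    thus ?thesis
      using True by (auto simp: T_def)
  qed (use main that in auto)
  thus ?thesis
    using \<open>0 < c\<close> unfolding oracle_bound_def T_def
    by (intro exI[of _ c]) (meson of_nat_mono order_trans)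
qed

end
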